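(* Let $\Omega, \Lambda \subset \mathbf{R}^d$ be bounded Lebesgue measurable sets with unit volume, and let $c(x,y) = -x \cdot y$. Let $p > 1$ and let $q$ be its Hölder conjugate, $p^{-1} + q^{-1} = 1$. For $r \in \{p,q\}$ set $\bar h_r := r\, 1_{\Omega \times \Lambda}$. Let $R(x,y) := (x,-y)$ on $\mathbf{R}^d \times \mathbf{R}^d$. Given any Lebesgue measurable set $W \subset \Omega \times \Lambda$, let $\tilde W := (\Omega \times \Lambda) \setminus W$, and let $R(\tilde W)$ be the image of $\tilde W$ under $R$. Then: (1) If $p 1_W \in \Gamma(1_\Omega, 1_\Lambda)^{\bar h_p}$, then $q 1_{\tilde W} \in \Gamma(1_\Omega, 1_\Lambda)^{\bar h_q}$. (2) $c[1_W] + b(\Omega) \cdot b(\Lambda) = -c[1_{\tilde W}] = c[1_{R(\tilde W)}]$, where $b(\Omega) = \int_\Omega x\,dx$ and $b(\Lambda) = \int_\Lambda y\,dy$ are the centers of mass of $\Omega$ and $\Lambda$. (3) $p 1_W$ minimizes $c[\cdot]$ on $\Gamma(1_\Omega, 1_\Lambda)^{\bar h_p}$ if and only if $q 1_{R(\tilde W)}$ minimizes $c[\cdot]$ on $\Gamma(1_\Omega, 1_{-\Lambda})^{q 1_{R(\Omega \times \Lambda)}}$.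
   Context: For $0 \le f, g \in L^1(\mathbf{R}^d)$ with $\int f = \int g$ and $0 \le \bar h \in L^1(\mathbf{R}^d \times \mathbf{R}^d)$, the set $\Gamma(f,g)^{\bar h}$ consists of all $0 \le h \in L^1(\mathbf{R}^d \times \mathbf{R}^d)$ (functions identified when equal Lebesgue-a.e.) such that $\int_{\mathbf{R}^d} h(x,\tilde y)\,d\tilde y = f(x)$ for Lebesgue-a.e. $x$, $\int_{\mathbf{R}^d} h(\tilde x,y)\,d\tilde x = g(y)$ for Lebesgue-a.e. $y$, and $h \le \bar h$ almost everywhere. The transportation cost of $h$ is $c[h] := \int_{\mathbf{R}^d \times \mathbf{R}^d} c(x,y) h(x,y)\,dx\,dy$. To say $h$ minimizes $c$ on $\Gamma$ means $h \in \Gamma$ and $c[h] \le c[k]$ for all $k \in \Gamma$. $1_A$ denotes the indicator function of the set $A$, and $-\Lambda = \{-y \mid y \in \Lambda\}$. *)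

theory Defs
  imports "HOL-Analysis.Analysis"
begin

text \<open>
  Elements of \<open>L\<^sup>1\<close> are represented by Lebesgue integrable functions, so every pointwise
  condition is imposed almost everywhere only. No integrability of the sections \<open>h (x, \<cdot>)\<close> and
  \<open>h (\<cdot>, y)\<close> is required separately: by Fubini it holds for almost every \<open>x\<close> and \<open>y\<close>.
\<close>

definition bounded_couplings ::
    "('a::euclidean_space \<Rightarrow> real) \<Rightarrow> ('b::euclidean_space \<Rightarrow> real) \<Rightarrow> ('a \<times> 'b \<Rightarrow> real)
      \<Rightarrow> ('a \<times> 'b \<Rightarrow> real) set" where
  "bounded_couplings f g hbar =
    {h. integrable lebesgue h \<and>
        (AE z in lebesgue. 0 \<le> h z) \<and>
        (AE x in lebesgue. (\<integral>y. h (x, y) \<partial>lebesgue) = f x) \<and>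
        (AE y in lebesgue. (\<integral>x. h (x, y) \<partial>lebesgue) = g y) \<and>
        (AE z in lebesgue. h z \<le> hbar z)}"

definition transport_cost ::
    "('a::euclidean_space \<times> 'b::euclidean_space \<Rightarrow> real) \<Rightarrow> ('a \<times> 'b \<Rightarrow> real) \<Rightarrow> real" where
  "transport_cost c h = (\<integral>z. c z * h z \<partial>lebesgue)"

definition minimizes_cost ::
    "('a::euclidean_space \<times> 'b::euclidean_space \<Rightarrow> real) \<Rightarrow> ('a \<times> 'b \<Rightarrow> real) set
      \<Rightarrow> ('a \<times> 'b \<Rightarrow> real) \<Rightarrow> bool" where
  "minimizes_cost c G h \<longleftrightarrow>
    h \<in> G \<and> (\<forall>k\<in>G. transport_cost c h \<le> transport_cost c k)"

definition bilinear_cost :: "'a::euclidean_space \<times> 'a \<Rightarrow> real" where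
  "bilinear_cost = (\<lambda>(x, y). - (x \<bullet> y))"

definition reflect_snd :: "'a::euclidean_space \<times> 'a \<Rightarrow> 'a \<times> 'a" where
  "reflect_snd = (\<lambda>(x, y). (x, - y))"

text \<open>The integral is not divided by the volume; it is the center of mass for unit volume sets.\<close>

definition center_of_mass :: "'a::euclidean_space set \<Rightarrow> 'a" where
  "center_of_mass S = (LINT x:S|lebesgue. x)"

end

theory Submission
  imports Defs
begin

text \<open>
  Write \<open>S = \<Omega> \<times> \<Lambda>\<close>. Complementation \<open>W \<mapsto> S - W\<close> is the restriction to scaled indicators of the affine
  map \<open>h \<mapsto> q 1\<^sub>S - (q - 1) h\<close> on densities (\<open>conjugate_density\<close>). Since \<open>p (q - 1) = q\<close>, it exchanges
  the constraints \<open>0 \<le> h\<close> and \<open>h \<le> p 1\<^sub>S\<close> with \<open>k \<le> q 1\<^sub>S\<close> and \<open>0 \<le> k\<close>; since \<open>1\<^sub>S\<close> has the marginals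
  \<open>1\<^sub>\<Omega>\<close> and \<open>1\<^sub>\<Lambda>\<close> and \<open>q - (q - 1) = 1\<close>, it keeps the marginals
  (\<open>conjugate_density_bounded_couplings\<close>). The same map with \<open>p\<close> in place of \<open>q\<close> is its inverse, so
  it is a bijection between all competitors for \<open>p\<close> and all competitors for \<open>q\<close>, not only between
  the indicators among them.

  On costs this bijection is affine with slope \<open>- (q - 1)\<close>, so it reverses the order and turns
  minimizers into maximizers. The reflection \<open>R\<close> preserves Lebesgue measure and changes the sign of
  \<open>x \<bullet> y\<close>, hence of the cost; composed with conjugation it gives an order preserving bijection onto
  the competitors with second marginal \<open>1\<^bsub>- \<Lambda>\<^esub>\<close>, and minimizers correspond
  (\<open>minimizes_cost_iff_increasing_image\<close>).

  The constant \<open>b(\<Omega>) \<bullet> b(\<Lambda>)\<close> is minus the cost of \<open>1\<^sub>S\<close>, by Fubini's theorem, and \<open>1\<^sub>S = 1\<^sub>W + 1\<^bsub>S - W\<^esub>\<close>.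
\<close>


section \<open>Lebesgue measure on product spaces\<close>

lemma AE_lebesgue_sections:
  fixes P :: "'a::euclidean_space \<times> 'b::euclidean_space \<Rightarrow> bool"
  assumes "AE z in lebesgue. P z"
  shows "AE x in lebesgue. AE y in lebesgue. P (x, y)"
proof -
  have "AE z in lborel \<Otimes>\<^sub>M lborel. P z"
    using assms unfolding lborel_prod AE_completion_iff .
  then show ?thesis
    by (simp add: AE_completion_iff lborel_pair.AE_pair)
qed

text \<open>
  The library proves Fubini's theorem for products of measures, but \<^term>\<open>lebesgue\<close> on a product
  space is only the completion of such a product. An integrable function agrees outside a null set
  with a Borel function, and almost every section of a null set is null; hence the two functions
  have, for almost every \<open>x\<close>, sections that are equal almost everywhere.
\<close>

lemma Fubini_lebesgue:
  fixes h :: "'a::euclidean_space \<times> 'b::euclidean_space \<Rightarrow> real"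
  assumes h: "integrable lebesgue h"
  shows AE_integrable_lebesgue_sections: "AE x in lebesgue. integrable lebesgue (\<lambda>y. h (x, y))"
    and lebesgue_integral_sections:
      "(\<integral>x. (\<integral>y. h (x, y) \<partial>lebesgue) \<partial>lebesgue) = (\<integral>z. h z \<partial>lebesgue)"
proof -
  obtain k where k [measurable]: "k \<in> borel_measurable lborel" and hk: "AE z in lborel. h z = k z"
    using completion_ex_borel_measurable_real[of h lborel] h by auto
  have hk': "AE z in lebesgue. h z = k z"
    using hk by (rule AE_completion)
  have [measurable]: "h \<in> borel_measurable lebesgue" "k \<in> borel_measurable lebesgue"
    using h k by (auto intro: measurable_completion)
  have int_k: "integrable lborel k"
    using h hk' integrable_cong_AE[of h lebesgue k] k by (simp add: integrable_completion)
  then have int_k': "integrable (lborel \<Otimes>\<^sub>M lborel) k"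
    by (simp add: lborel_prod)
  have sec: "AE x in lebesgue. integrable lborel (\<lambda>y. k (x, y))"
    by (rule AE_completion) (rule lborel_pair.AE_integrable_fst'[OF int_k'])
  have good: "AE x in lebesgue. integrable lebesgue (\<lambda>y. h (x, y)) \<and>
      (\<integral>y. h (x, y) \<partial>lebesgue) = (\<integral>y. k (x, y) \<partial>lborel)"
    using AE_lebesgue_sections[OF hk'] sec
  proof eventually_elim
    case (elim x)
    have kx [measurable]: "(\<lambda>y. k (x, y)) \<in> borel_measurable lborel"
      using elim(2) by auto
    then have [measurable]: "(\<lambda>y. k (x, y)) \<in> borel_measurable lebesgue"
      by (rule measurable_completion)
    have hx [measurable]: "(\<lambda>y. h (x, y)) \<in> borel_measurable lebesgue"
      by (rule borel_measurable_AE[of "\<lambda>y. k (x, y)"]) (use elim(1) in \<open>auto simp: eq_commute\<close>)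
    have "integrable lebesgue (\<lambda>y. k (x, y))"
      using elim(2) kx by (simp add: integrable_completion)
    then have "integrable lebesgue (\<lambda>y. h (x, y))"
      by (rule integrable_cong_AE_imp) (use elim(1) in \<open>auto simp: eq_commute\<close>)
    moreover have "(\<integral>y. h (x, y) \<partial>lebesgue) = (\<integral>y. k (x, y) \<partial>lebesgue)"
      by (rule integral_cong_AE) (use elim(1) in auto)
    ultimately show ?case
      using kx by (simp add: integral_completion)
  qed
  then show "AE x in lebesgue. integrable lebesgue (\<lambda>y. h (x, y))"
    by eventually_elim simp
  have K [measurable]: "(\<lambda>x. \<integral>y. k (x, y) \<partial>lborel) \<in> borel_measurable lborel"
    using lborel_pair.integrable_fst'[OF int_k'] by auto
  then have [measurable]: "(\<lambda>x. \<integral>y. k (x, y) \<partial>lborel) \<in> borel_measurable lebesgue"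
    by (rule measurable_completion)
  have "(\<lambda>x. \<integral>y. h (x, y) \<partial>lebesgue) \<in> borel_measurable lebesgue"
    by (rule borel_measurable_AE[of "\<lambda>x. \<integral>y. k (x, y) \<partial>lborel"]) (use good in auto)
  then have "(\<integral>x. (\<integral>y. h (x, y) \<partial>lebesgue) \<partial>lebesgue) = (\<integral>x. (\<integral>y. k (x, y) \<partial>lborel) \<partial>lebesgue)"
    by (intro integral_cong_AE) (use good in auto)
  also have "\<dots> = (\<integral>x. (\<integral>y. k (x, y) \<partial>lborel) \<partial>lborel)"
    using K by (rule integral_completion)
  also have "\<dots> = (\<integral>z. k z \<partial>lborel)"
    by (simp add: lborel_pair.integral_fst'[OF int_k'] lborel_prod)
  also have "\<dots> = (\<integral>z. k z \<partial>lebesgue)"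
    using k by (simp add: integral_completion)
  also have "\<dots> = (\<integral>z. h z \<partial>lebesgue)"
    by (rule integral_cong_AE) (use hk' in \<open>auto simp: eq_commute\<close>)
  finally show "(\<integral>x. (\<integral>y. h (x, y) \<partial>lebesgue) \<partial>lebesgue) = (\<integral>z. h z \<partial>lebesgue)" .
qed

lemma lebesgue_measurable_if_null_preserving:
  fixes T :: "'a::euclidean_space \<Rightarrow> 'b::euclidean_space"
  assumes "T \<in> borel_measurable borel"
    and "\<And>N. N \<in> null_sets lborel \<Longrightarrow> emeasure lborel (T -` N) = 0"
  shows "T \<in> lebesgue \<rightarrow>\<^sub>M lebesgue"
proof -
  have "T \<in> lebesgue \<rightarrow>\<^sub>M lborel"
    using assms(1) by (intro measurable_completion) simp
  moreover have "null_sets lborel \<subseteq> null_sets (distr lebesgue lborel T)"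
  proof
    fix N :: "'b set" assume N: "N \<in> null_sets lborel"
    then have "T -` N \<in> sets borel"
      using measurable_sets[OF assms(1), of N] by auto
    then show "N \<in> null_sets (distr lebesgue lborel T)"
      using N assms \<open>T \<in> lebesgue \<rightarrow>\<^sub>M lborel\<close> by (auto simp: null_sets_def emeasure_distr)
  qed
  ultimately show ?thesis
    by (rule completion.measurable_completion2)
qed

text \<open>
  Measurability of the projections for the completed measures makes \<open>A \<times> B\<close> Lebesgue measurable
  when \<open>A\<close> and \<open>B\<close> are merely Lebesgue measurable.
\<close>

lemma lebesgue_measurable_fst: "fst \<in> (lebesgue :: ('a::euclidean_space \<times> 'b::euclidean_space) measure) \<rightarrow>\<^sub>M lebesgue"
proof (rule lebesgue_measurable_if_null_preserving)
  fix N :: "'a set" assume N: "N \<in> null_sets lborel"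
  have "fst -` N = N \<times> (UNIV :: 'b set)" by auto
  then have "emeasure lborel (fst -` N :: ('a \<times> 'b) set) =
      emeasure (lborel \<Otimes>\<^sub>M lborel) (N \<times> (UNIV :: 'b set))"
    by (simp add: lborel_prod)
  also have "\<dots> = 0"
    using N by (subst lborel.emeasure_pair_measure_Times) auto
  finally show "emeasure lborel (fst -` N :: ('a \<times> 'b) set) = 0" .
qed (rule borel_measurable_continuous_onI, intro continuous_intros)

lemma lebesgue_measurable_snd: "snd \<in> (lebesgue :: ('a::euclidean_space \<times> 'b::euclidean_space) measure) \<rightarrow>\<^sub>M lebesgue"
proof (rule lebesgue_measurable_if_null_preserving)
  fix N :: "'b set" assume N: "N \<in> null_sets lborel"
  have "snd -` N = (UNIV :: 'a set) \<times> N" by auto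
  then have "emeasure lborel (snd -` N :: ('a \<times> 'b) set) =
      emeasure (lborel \<Otimes>\<^sub>M lborel) ((UNIV :: 'a set) \<times> N)"
    by (simp add: lborel_prod)
  also have "\<dots> = 0"
    using N by (subst lborel.emeasure_pair_measure_Times) auto
  finally show "emeasure lborel (snd -` N :: ('a \<times> 'b) set) = 0" .
qed (rule borel_measurable_continuous_onI, intro continuous_intros)

text \<open>
  A Borel map that preserves Lebesgue measure on Borel sets pulls Borel null sets back to null sets,
  so it preserves the completed measure too. The three instances needed are the swap of the factors,
  which exchanges the two marginals, and the reflections \<open>y \<mapsto> - y\<close> and \<^term>\<open>reflect_snd\<close>.
\<close>

lemma lebesgue_preserving:
  fixes T :: "'a::euclidean_space \<Rightarrow> 'b::euclidean_space"
  assumes T: "T \<in> borel_measurable borel" and "distr lborel lborel T = lborel"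
  shows lebesgue_measurable_preserving: "T \<in> lebesgue \<rightarrow>\<^sub>M lebesgue"
    and distr_lebesgue_preserving: "distr lebesgue lebesgue T = lebesgue"
proof -
  have T': "T \<in> lebesgue \<rightarrow>\<^sub>M lborel"
    using T by (intro measurable_completion) simp
  have d: "distr lebesgue lborel T = lborel"
    using assms by (subst distr_completion) auto
  show "T \<in> lebesgue \<rightarrow>\<^sub>M lebesgue"
    using T' by (rule completion.measurable_completion2) (simp add: d)
  show "distr lebesgue lebesgue T = lebesgue"
    using completion.completion_distr_eq[OF T'] by (simp add: d)
qed

lemma distr_lborel_swap:
  "distr lborel lborel prod.swap = (lborel :: ('b::euclidean_space \<times> 'a::euclidean_space) measure)"
  using lborel_pair.distr_pair_swap[where 'a='b and 'b='a]
  by (simp add: lborel_prod case_prod_beta' prod.swap_def[abs_def])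

lemma distr_lborel_uminus:
  "distr lborel lborel uminus = (lborel :: 'a::euclidean_space measure)"
  using lborel_affine_euclidean[of "\<lambda>_::'a. -1" 0]
  by (simp add: sum_negf euclidean_representation density_1 one_ennreal_def[symmetric] cong: distr_cong)

lemma distr_lborel_reflect_snd:
  "distr lborel lborel reflect_snd = (lborel :: ('a::euclidean_space \<times> 'a) measure)"
proof -
  have "distr lborel lborel (\<lambda>x. x) \<Otimes>\<^sub>M distr lborel lborel uminus =
      distr (lborel \<Otimes>\<^sub>M lborel) (lborel \<Otimes>\<^sub>M lborel) (\<lambda>(x, y). (x, - y) :: 'a \<times> 'a)"
    by (rule pair_measure_distr) (auto simp: distr_lborel_uminus sigma_finite_lborel)
  then show ?thesis
    by (simp add: distr_lborel_uminus distr_id lborel_prod reflect_snd_def)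
qed

lemma sets_lebesgue_Times:
  fixes A :: "'a::euclidean_space set" and B :: "'b::euclidean_space set"
  assumes "A \<in> sets lebesgue" "B \<in> sets lebesgue"
  shows "A \<times> B \<in> sets lebesgue"
proof -
  have "fst -` A \<inter> space lebesgue \<inter> (snd -` B \<inter> space lebesgue) \<in> sets (lebesgue :: ('a \<times> 'b) measure)"
    using assms by (intro sets.Int measurable_sets[OF lebesgue_measurable_fst]
        measurable_sets[OF lebesgue_measurable_snd])
  also have "fst -` A \<inter> space lebesgue \<inter> (snd -` B \<inter> space lebesgue) = A \<times> B"
    by auto
  finally show ?thesis .
qed

lemma
  fixes T :: "'a::euclidean_space \<Rightarrow> 'b::euclidean_space"
  assumes T: "T \<in> borel_measurable borel" and d: "distr lborel lborel T = lborel"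
  shows AE_lebesgue_preserving: "(AE x in lebesgue. P x) \<Longrightarrow> (AE x in lebesgue. P (T x))"
    and integrable_lebesgue_preserving:
      "integrable lebesgue h \<Longrightarrow> integrable lebesgue (\<lambda>x. h (T x) :: real)"
    and integral_lebesgue_preserving:
      "integrable lebesgue h \<Longrightarrow> (\<integral>x. h (T x) \<partial>lebesgue) = (\<integral>x. h x \<partial>lebesgue :: real)"
proof -
  note m = lebesgue_measurable_preserving[OF T d] and d' = distr_lebesgue_preserving[OF T d]
  show "(AE x in lebesgue. P x) \<Longrightarrow> (AE x in lebesgue. P (T x))"
    using AE_distrD[OF m, of P] unfolding d' .
  show "integrable lebesgue h \<Longrightarrow> integrable lebesgue (\<lambda>x. h (T x) :: real)"
    using integrable_distr[OF m, of h] by (simp add: d')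
  show "integrable lebesgue h \<Longrightarrow> (\<integral>x. h (T x) \<partial>lebesgue) = (\<integral>x. h x \<partial>lebesgue :: real)"
    using integral_distr[OF m, of h] by (simp add: d')
qed

lemma borel_measurable_reflections:
  shows borel_measurable_swap:
      "prod.swap \<in> borel_measurable (borel :: ('a::euclidean_space \<times> 'b::euclidean_space) measure)"
    and borel_measurable_neg: "uminus \<in> borel_measurable (borel :: 'a measure)"
    and borel_measurable_reflect_snd:
      "reflect_snd \<in> borel_measurable (borel :: ('a \<times> 'a) measure)"
  by (rule borel_measurable_continuous_onI;
      auto simp: prod.swap_def[abs_def] reflect_snd_def case_prod_beta' intro!: continuous_intros)+

lemmas swap_preserving = borel_measurable_swap distr_lborel_swap
lemmas uminus_preserving = borel_measurable_neg distr_lborel_uminus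
lemmas reflect_snd_preserving = borel_measurable_reflect_snd distr_lborel_reflect_snd

lemma AE_integrable_lebesgue_sections_snd:
  fixes h :: "'a::euclidean_space \<times> 'b::euclidean_space \<Rightarrow> real"
  assumes "integrable lebesgue h"
  shows "AE y in lebesgue. integrable lebesgue (\<lambda>x. h (x, y))"
  using AE_integrable_lebesgue_sections[OF integrable_lebesgue_preserving[OF swap_preserving assms]]
  by simp


section \<open>The bilinear cost\<close>

lemma reflect_snd_reflect_snd [simp]: "reflect_snd (reflect_snd z) = z"
  by (simp add: reflect_snd_def split: prod.splits)

lemma bilinear_cost_reflect_snd [simp]: "bilinear_cost (reflect_snd z) = - bilinear_cost z"
  by (simp add: bilinear_cost_def reflect_snd_def split: prod.splits)

lemma indicator_reflect_snd_image:
  "indicator (reflect_snd ` S) z = (indicator S (reflect_snd z) :: real)"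
  by (auto simp: indicator_def image_iff) (metis reflect_snd_reflect_snd)

lemma indicator_uminus_image:
  fixes B :: "'a::euclidean_space set"
  shows "indicator (uminus ` B) y = (indicator B (- y) :: real)"
  by (auto simp: indicator_def image_iff) (metis minus_minus)

text \<open>
  The cost is unbounded on the whole space; costs are finite because the densities of interest
  vanish outside a bounded set.
\<close>

lemma integrable_bilinear_cost_mult:
  fixes h :: "'a::euclidean_space \<times> 'a \<Rightarrow> real"
  assumes h: "integrable lebesgue h" and S: "bounded S"
    and zero: "AE z in lebesgue. z \<notin> S \<longrightarrow> h z = 0"
  shows "integrable lebesgue (\<lambda>z. bilinear_cost z * h z)"
proof -
  obtain K where K: "\<And>z. z \<in> S \<Longrightarrow> norm z \<le> K"
    using S by (auto simp: bounded_iff)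
  have c: "\<bar>bilinear_cost z\<bar> \<le> K * K" if "z \<in> S" for z :: "'a \<times> 'a"
  proof -
    obtain x y where z: "z = (x, y)" by (cases z)
    have "\<bar>x \<bullet> y\<bar> \<le> norm x * norm y"
      by (rule Cauchy_Schwarz_ineq2)
    also have "\<dots> \<le> K * K"
      using K[OF that] norm_fst_le[of x y] norm_snd_le[of y x] unfolding z
      by (intro mult_mono) (auto intro: order_trans[OF norm_ge_zero])
    finally show ?thesis
      by (simp add: z bilinear_cost_def)
  qed
  have "(bilinear_cost :: 'a \<times> 'a \<Rightarrow> real) \<in> borel_measurable borel"
    unfolding bilinear_cost_def case_prod_beta'
    by (intro borel_measurable_continuous_onI continuous_intros)
  then have [measurable]: "(bilinear_cost :: 'a \<times> 'a \<Rightarrow> real) \<in> borel_measurable lebesgue"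
    by (intro measurable_completion) simp
  show ?thesis
  proof (rule Bochner_Integration.integrable_bound)
    show "integrable lebesgue (\<lambda>z. K * K * h z)"
      using h by simp
    show "(\<lambda>z. bilinear_cost z * h z) \<in> borel_measurable lebesgue"
      using h by measurable
    show "AE z in lebesgue. norm (bilinear_cost z * h z) \<le> norm (K * K * h z)"
      using zero
    proof eventually_elim
      case (elim z)
      show ?case
      proof (cases "z \<in> S")
        case True
        then have "\<bar>bilinear_cost z\<bar> * \<bar>h z\<bar> \<le> K * K * \<bar>h z\<bar>"
          by (intro mult_right_mono c) auto
        then show ?thesis by (simp add: abs_mult)
      qed (use elim in simp)
    qed
  qed
qed

lemma transport_cost_reflect_snd:
  fixes h :: "'a::euclidean_space \<times> 'a \<Rightarrow> real"
  assumes "integrable lebesgue (\<lambda>z. bilinear_cost z * h z)"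
  shows "transport_cost bilinear_cost (\<lambda>z. h (reflect_snd z)) = - transport_cost bilinear_cost h"
  using integral_lebesgue_preserving[OF reflect_snd_preserving assms]
  by (simp add: transport_cost_def)

lemma set_integrable_lebesgue_ident:
  fixes A :: "'a::euclidean_space set"
  assumes "bounded A" "A \<in> lmeasurable"
  shows "set_integrable lebesgue A (\<lambda>x. x)"
proof -
  obtain K where "\<And>x. x \<in> A \<Longrightarrow> norm x \<le> K"
    using assms by (auto simp: bounded_iff)
  then show ?thesis
    unfolding set_integrable_def using assms
    by (intro integrableI_bounded_set_indicator[where B=K])
       (auto simp: fmeasurable_def intro!: measurable_completion)
qed

lemma integrable_indicator_Times:
  fixes A :: "'a::euclidean_space set" and B :: "'b::euclidean_space set"
  assumes "bounded A" "A \<in> sets lebesgue" "bounded B" "B \<in> sets lebesgue"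
    and "X \<in> sets lebesgue" "X \<subseteq> A \<times> B"
  shows "integrable lebesgue (indicator X :: _ \<Rightarrow> real)"
proof -
  have "bounded X"
    using bounded_subset[OF bounded_Times] assms by blast
  then have "X \<in> lmeasurable"
    using assms by (simp add: bounded_set_imp_lmeasurable)
  then show ?thesis
    by (intro integrable_real_indicator) (simp_all add: fmeasurable_def del: emeasure_completion)
qed

text \<open>
  By Fubini: for fixed \<open>x\<close> the inner product is linear in \<open>y\<close>, so the integral over \<open>B\<close> replaces \<open>y\<close> by
  the center of mass of \<open>B\<close>, and the integral over \<open>A\<close> does the same for \<open>x\<close>.
\<close>

lemma transport_cost_Times:
  fixes A B :: "'a::euclidean_space set"
  assumes A: "bounded A" "A \<in> sets lebesgue" and B: "bounded B" "B \<in> sets lebesgue"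
  shows "transport_cost bilinear_cost (indicator (A \<times> B)) = - (center_of_mass A \<bullet> center_of_mass B)"
proof -
  have lm: "A \<in> lmeasurable" "B \<in> lmeasurable"
    using A B by (auto simp: bounded_set_imp_lmeasurable)
  have intA: "integrable lebesgue (\<lambda>x. indicator A x *\<^sub>R x)"
    and intB: "integrable lebesgue (\<lambda>x. indicator B x *\<^sub>R x)"
    using set_integrable_lebesgue_ident A B lm by (auto simp: set_integrable_def)
  have "integrable lebesgue (\<lambda>z. bilinear_cost z * indicator (A \<times> B) z)"
    using A B by (intro integrable_bilinear_cost_mult[of _ "A \<times> B"] integrable_indicator_Times[OF A B]
        bounded_Times sets_lebesgue_Times) auto
  then have "transport_cost bilinear_cost (indicator (A \<times> B)) =
      (\<integral>x. (\<integral>y. bilinear_cost (x, y) * indicator (A \<times> B) (x, y) \<partial>lebesgue) \<partial>lebesgue)"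
    unfolding transport_cost_def by (rule lebesgue_integral_sections[symmetric])
  also have "\<dots> = (\<integral>x. (\<integral>y. - (indicator A x *\<^sub>R x) \<bullet> (indicator B y *\<^sub>R y) \<partial>lebesgue) \<partial>lebesgue)"
    by (simp add: bilinear_cost_def indicator_times mult_ac)
  also have "\<dots> = (\<integral>x. - ((indicator A x *\<^sub>R x) \<bullet> center_of_mass B) \<partial>lebesgue)"
    by (subst integral_inner_right) (simp_all add: intB center_of_mass_def set_lebesgue_integral_def)
  also have "\<dots> = - (center_of_mass A \<bullet> center_of_mass B)"
    using intA integral_inner_left[of "center_of_mass B" lebesgue "\<lambda>x. indicator A x *\<^sub>R x"]
    by (simp add: center_of_mass_def set_lebesgue_integral_def)
  finally show ?thesis .
qed


section \<open>Conjugate densities and reflected densities\<close>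

text \<open>
  For \<open>h = p 1\<^sub>W\<close> with \<open>W \<subseteq> S\<close> this is \<open>q 1\<^bsub>S - W\<^esub>\<close>, because \<open>p (q - 1) = q\<close>. Unlike the passage from \<open>W\<close>
  to \<open>S - W\<close> it makes sense for every density, and so for every competitor of \<open>p 1\<^sub>W\<close>. The coefficients
  sum to \<open>1\<close>, which is what keeps the marginals fixed.
\<close>

definition conjugate_density :: "real \<Rightarrow> 'c set \<Rightarrow> ('c \<Rightarrow> real) \<Rightarrow> 'c \<Rightarrow> real" where
  "conjugate_density q S h z = q * indicator S z - (q - 1) * h z"

lemma conjugate_exponent:
  fixes p q :: real
  assumes "p > 1" "1 / p + 1 / q = 1"
  shows "q > 1" "p * (q - 1) = q" "q * (p - 1) = p"
proof -
  have "q \<noteq> 0" using assms by auto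
  then have *: "p + q = p * q"
    using assms by (simp add: field_simps)
  then show "p * (q - 1) = q" "q * (p - 1) = p"
    by (simp_all add: algebra_simps)
  show "q > 1"
    using * assms by (smt (verit) \<open>q \<noteq> 0\<close> mult_less_cancel_left1 mult_less_cancel_right2 mult_le_0_iff)
qed

lemma conjugate_density_involutive:
  assumes "p > 1" "1 / p + 1 / q = 1"
  shows "conjugate_density p S (conjugate_density q S h) = h"
proof
  fix z
  have "(p - 1) * (q - 1) = 1"
    using conjugate_exponent[OF assms] by (simp add: algebra_simps)
  moreover have "conjugate_density p S (conjugate_density q S h) z
      = (p - q * (p - 1)) * indicator S z + ((p - 1) * (q - 1)) * h z"
    by (simp add: conjugate_density_def algebra_simps)
  ultimately show "conjugate_density p S (conjugate_density q S h) z = h z"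
    using conjugate_exponent[OF assms] by simp
qed

lemma conjugate_density_indicator:
  assumes "p > 1" "1 / p + 1 / q = 1" "W \<subseteq> S"
  shows "conjugate_density q S (\<lambda>z. p * indicator W z) = (\<lambda>z. q * indicator (S - W) z)"
  using conjugate_exponent[OF assms(1,2)] assms(3)
  by (auto simp: conjugate_density_def indicator_def fun_eq_iff algebra_simps)

text \<open>
  Conjugation exchanges the two pointwise constraints: \<open>0 \<le> h\<close> becomes the upper bound by \<open>q\<close>, and
  \<open>h \<le> p\<close> becomes nonnegativity. Unit volume makes \<open>1\<^sub>A\<close> and \<open>1\<^sub>B\<close> the marginals of \<open>1\<^bsub>A \<times> B\<^esub>\<close>.
\<close>

lemma conjugate_density_bounded_couplings:
  fixes A :: "'a::euclidean_space set" and B :: "'b::euclidean_space set"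
  assumes A: "bounded A" "A \<in> sets lebesgue" "emeasure lebesgue A = 1"
    and B: "bounded B" "B \<in> sets lebesgue" "emeasure lebesgue B = 1"
    and pq: "p > 1" "1 / p + 1 / q = 1"
    and h: "h \<in> bounded_couplings (indicator A) (indicator B) (\<lambda>z. p * indicator (A \<times> B) z)"
  shows "conjugate_density q (A \<times> B) h
    \<in> bounded_couplings (indicator A) (indicator B) (\<lambda>z. q * indicator (A \<times> B) z)"
proof -
  note q = conjugate_exponent[OF pq]
  have int_h: "integrable lebesgue h"
    and nonneg: "AE z in lebesgue. 0 \<le> h z"
    and f: "AE x in lebesgue. (\<integral>y. h (x, y) \<partial>lebesgue) = indicator A x"
    and g: "AE y in lebesgue. (\<integral>x. h (x, y) \<partial>lebesgue) = indicator B y"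
    and le: "AE z in lebesgue. h z \<le> p * indicator (A \<times> B) z"
    using h by (auto simp: bounded_couplings_def)
  have measure1: "measure lebesgue A = 1" "measure lebesgue B = 1"
    using A B by (simp_all add: measure_def)
  have intA: "integrable lebesgue (indicator A :: _ \<Rightarrow> real)"
    and intB: "integrable lebesgue (indicator B :: _ \<Rightarrow> real)"
    using A B by (simp_all add: integrable_indicator_iff)
  have "integrable lebesgue (conjugate_density q (A \<times> B) h)"
    unfolding conjugate_density_def using int_h
    by (intro Bochner_Integration.integrable_diff integrable_mult_right
        integrable_indicator_Times[OF A(1,2) B(1,2)] sets_lebesgue_Times A B) auto
  moreover have "AE z in lebesgue. 0 \<le> conjugate_density q (A \<times> B) h z"
    using le
  proof eventually_elim
    case (elim z)
    then have "(q - 1) * h z \<le> (q - 1) * (p * indicator (A \<times> B) z)"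
      using q by (intro mult_left_mono) auto
    also have "\<dots> = p * (q - 1) * indicator (A \<times> B) z"
      by simp
    finally show ?case
      using q by (simp add: conjugate_density_def)
  qed
  moreover have "AE z in lebesgue. conjugate_density q (A \<times> B) h z \<le> q * indicator (A \<times> B) z"
    using nonneg by eventually_elim (use q in \<open>simp add: conjugate_density_def\<close>)
  moreover have "AE x in lebesgue. (\<integral>y. conjugate_density q (A \<times> B) h (x, y) \<partial>lebesgue) = indicator A x"
    using AE_integrable_lebesgue_sections[OF int_h] f
  proof eventually_elim
    case (elim x)
    then have "(\<integral>y. conjugate_density q (A \<times> B) h (x, y) \<partial>lebesgue)
        = q * indicator A x - (q - 1) * indicator A x"
      using intB B measure1 by (simp add: conjugate_density_def indicator_times)
    then show ?case by (simp add: algebra_simps)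
  qed
  moreover have "AE y in lebesgue. (\<integral>x. conjugate_density q (A \<times> B) h (x, y) \<partial>lebesgue) = indicator B y"
    using AE_integrable_lebesgue_sections_snd[OF int_h] g
  proof eventually_elim
    case (elim y)
    then have "(\<integral>x. conjugate_density q (A \<times> B) h (x, y) \<partial>lebesgue)
        = q * indicator B y - (q - 1) * indicator B y"
      using intA A measure1 by (simp add: conjugate_density_def indicator_times)
    then show ?case by (simp add: algebra_simps)
  qed
  ultimately show ?thesis
    by (simp add: bounded_couplings_def)
qed

text \<open>
  The sections of \<open>h\<close> in \<open>y\<close> are reflected, which leaves their integrals unchanged; the sections in \<open>x\<close>
  are only relabelled, which reflects the second marginal.
\<close>

lemma reflect_snd_bounded_couplings:
  fixes h :: "'a::euclidean_space \<times> 'a \<Rightarrow> real"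
  assumes h: "h \<in> bounded_couplings f g hbar"
  shows "(\<lambda>z. h (reflect_snd z)) \<in> bounded_couplings f (\<lambda>y. g (- y)) (\<lambda>z. hbar (reflect_snd z))"
proof -
  have int_h: "integrable lebesgue h"
    and nonneg: "AE z in lebesgue. 0 \<le> h z"
    and f: "AE x in lebesgue. (\<integral>y. h (x, y) \<partial>lebesgue) = f x"
    and g: "AE y in lebesgue. (\<integral>x. h (x, y) \<partial>lebesgue) = g y"
    and le: "AE z in lebesgue. h z \<le> hbar z"
    using h by (auto simp: bounded_couplings_def)
  have "AE x in lebesgue. (\<integral>y. h (reflect_snd (x, y)) \<partial>lebesgue) = f x"
    using AE_integrable_lebesgue_sections[OF int_h] f
  proof eventually_elim
    case (elim x)
    then show ?case
      using integral_lebesgue_preserving[OF uminus_preserving elim(1)]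
      by (simp add: reflect_snd_def)
  qed
  moreover have "AE y in lebesgue. (\<integral>x. h (reflect_snd (x, y)) \<partial>lebesgue) = g (- y)"
    using AE_lebesgue_preserving[OF uminus_preserving g] by (simp add: reflect_snd_def)
  ultimately show ?thesis
    using integrable_lebesgue_preserving[OF reflect_snd_preserving int_h]
      AE_lebesgue_preserving[OF reflect_snd_preserving nonneg]
      AE_lebesgue_preserving[OF reflect_snd_preserving le]
    by (simp add: bounded_couplings_def)
qed

lemma integrable_bilinear_cost_coupling:
  fixes h :: "'a::euclidean_space \<times> 'a \<Rightarrow> real"
  assumes S: "bounded S" and h: "h \<in> bounded_couplings f g (\<lambda>z. p * indicator S z)"
  shows "integrable lebesgue (\<lambda>z. bilinear_cost z * h z)"
proof (rule integrable_bilinear_cost_mult[OF _ S])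
  show "integrable lebesgue h"
    using h by (simp add: bounded_couplings_def)
  have "AE z in lebesgue. 0 \<le> h z" "AE z in lebesgue. h z \<le> p * indicator S z"
    using h by (auto simp: bounded_couplings_def)
  then show "AE z in lebesgue. z \<notin> S \<longrightarrow> h z = 0"
    by eventually_elim auto
qed

lemma transport_cost_conjugate_density:
  assumes "integrable lebesgue (\<lambda>z. c z * h z)" "integrable lebesgue (\<lambda>z. c z * indicator S z)"
  shows "transport_cost c (conjugate_density q S h)
    = q * transport_cost c (indicator S) - (q - 1) * transport_cost c h"
proof -
  have "transport_cost c (conjugate_density q S h)
      = (\<integral>z. q * (c z * indicator S z) - (q - 1) * (c z * h z) \<partial>lebesgue)"
    unfolding transport_cost_def conjugate_density_def
    by (rule Bochner_Integration.integral_cong) (simp_all add: algebra_simps)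
  also have "\<dots> = q * transport_cost c (indicator S) - (q - 1) * transport_cost c h"
    using assms by (simp add: transport_cost_def del: right_diff_distrib left_diff_distrib)
  finally show ?thesis .
qed


section \<open>Transfer of minimizers\<close>

text \<open>
  The inverse is required for all functions and not only on the feasible sets: only then
  does \<open>F h \<in> G'\<close> force \<open>h \<in> G\<close>, so that a function outside \<open>G\<close> is mapped outside \<open>G'\<close>.
\<close>

lemma minimizes_cost_iff_increasing_image:
  assumes "\<And>h. h \<in> G \<Longrightarrow> F h \<in> G'" and "\<And>k. k \<in> G' \<Longrightarrow> F' k \<in> G"
    and "\<And>h. F' (F h) = h" and "\<And>k. F (F' k) = k"
    and cost: "\<And>h. h \<in> G \<Longrightarrow> transport_cost c' (F h) = \<alpha> + \<beta> * transport_cost c h"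
    and "\<beta> > 0"
  shows "minimizes_cost c G h \<longleftrightarrow> minimizes_cost c' G' (F h)"
proof -
  have G: "h \<in> G \<longleftrightarrow> F h \<in> G'" for h
    using assms(1-3) by metis
  have "(\<forall>k\<in>G. transport_cost c h \<le> transport_cost c k)
      \<longleftrightarrow> (\<forall>k\<in>G'. transport_cost c' (F h) \<le> transport_cost c' k)" if "h \<in> G"
  proof -
    have "(\<forall>k\<in>G'. transport_cost c' (F h) \<le> transport_cost c' k)
        \<longleftrightarrow> (\<forall>k\<in>G. transport_cost c' (F h) \<le> transport_cost c' (F k))"
      using assms(1,2,4) by metis
    also have "\<dots> \<longleftrightarrow> (\<forall>k\<in>G. transport_cost c h \<le> transport_cost c k)"
      using that \<open>\<beta> > 0\<close> by (simp add: cost)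
    finally show ?thesis by simp
  qed
  then show ?thesis
    using G by (auto simp: minimizes_cost_def)
qed


theorem lemma4p1:
  fixes \<Omega> \<Lambda> :: "(real ^ 'n) set" and p q :: real
    and W :: "((real ^ 'n) \<times> (real ^ 'n)) set"
  assumes "bounded \<Omega>" and "\<Omega> \<in> sets lebesgue" and "emeasure lebesgue \<Omega> = 1"
    and "bounded \<Lambda>" and "\<Lambda> \<in> sets lebesgue" and "emeasure lebesgue \<Lambda> = 1"
    and "p > 1" and "1 / p + 1 / q = 1"
    and "W \<in> sets lebesgue" and "W \<subseteq> \<Omega> \<times> \<Lambda>"
  shows
    "((\<lambda>z. p * indicator W z)
        \<in> bounded_couplings (indicator \<Omega>) (indicator \<Lambda>) (\<lambda>z. p * indicator (\<Omega> \<times> \<Lambda>) z)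
      \<longrightarrow> (\<lambda>z. q * indicator (\<Omega> \<times> \<Lambda> - W) z)
        \<in> bounded_couplings (indicator \<Omega>) (indicator \<Lambda>) (\<lambda>z. q * indicator (\<Omega> \<times> \<Lambda>) z))
    \<and> (transport_cost bilinear_cost (indicator W) + center_of_mass \<Omega> \<bullet> center_of_mass \<Lambda>
          = - transport_cost bilinear_cost (indicator (\<Omega> \<times> \<Lambda> - W))
       \<and> - transport_cost bilinear_cost (indicator (\<Omega> \<times> \<Lambda> - W))
          = transport_cost bilinear_cost (indicator (reflect_snd ` (\<Omega> \<times> \<Lambda> - W))))
    \<and> (minimizes_cost bilinear_cost
          (bounded_couplings (indicator \<Omega>) (indicator \<Lambda>) (\<lambda>z. p * indicator (\<Omega> \<times> \<Lambda>) z))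
          (\<lambda>z. p * indicator W z)
       \<longleftrightarrow>
       minimizes_cost bilinear_cost
          (bounded_couplings (indicator \<Omega>) (indicator (uminus ` \<Lambda>))
            (\<lambda>z. q * indicator (reflect_snd ` (\<Omega> \<times> \<Lambda>)) z))
          (\<lambda>z. q * indicator (reflect_snd ` (\<Omega> \<times> \<Lambda> - W)) z))"
proof -
  define S where "S = \<Omega> \<times> \<Lambda>"
  note \<Omega> = assms(1-3) and \<Lambda> = assms(4-6) and pq = assms(7,8)
  have qp: "q > 1" "1 / q + 1 / p = 1"
    using conjugate_exponent[OF pq] pq by simp_all
  have S: "bounded S" "S \<in> sets lebesgue"
    using \<Omega> \<Lambda> by (simp_all add: S_def bounded_Times sets_lebesgue_Times)
  have WS: "W \<subseteq> S"
    using assms(10) by (simp add: S_def)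

  have int_cost: "integrable lebesgue (\<lambda>z. bilinear_cost z * indicator X z)"
    if "X \<in> sets lebesgue" "X \<subseteq> S" for X
    using that by (intro integrable_bilinear_cost_mult[OF _ S(1)]
        integrable_indicator_Times[OF \<Omega>(1,2) \<Lambda>(1,2)] AE_I2) (auto simp: S_def indicator_def)

  let ?\<Gamma>p = "bounded_couplings (indicator \<Omega>) (indicator \<Lambda>) (\<lambda>z. p * indicator S z)"
  let ?\<Gamma>q = "bounded_couplings (indicator \<Omega>) (indicator \<Lambda>) (\<lambda>z. q * indicator S z)"
  let ?\<Gamma>R = "bounded_couplings (indicator \<Omega>) (indicator (uminus ` \<Lambda>))
      (\<lambda>z. q * indicator (reflect_snd ` S) z)"
  have pq_coupling: "conjugate_density q S h \<in> ?\<Gamma>q" if "h \<in> ?\<Gamma>p" for h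
    using conjugate_density_bounded_couplings[OF \<Omega> \<Lambda> pq] that by (simp add: S_def)
  have qp_coupling: "conjugate_density p S k \<in> ?\<Gamma>p" if "k \<in> ?\<Gamma>q" for k
    using conjugate_density_bounded_couplings[OF \<Omega> \<Lambda> qp] that by (simp add: S_def)
  have reflect_iff: "(\<lambda>z. k (reflect_snd z)) \<in> ?\<Gamma>R \<longleftrightarrow> k \<in> ?\<Gamma>q" for k
    using reflect_snd_bounded_couplings[of k "indicator \<Omega>" "indicator \<Lambda>" "\<lambda>z. q * indicator S z"]
      reflect_snd_bounded_couplings[of "\<lambda>z. k (reflect_snd z)" "indicator \<Omega>" "indicator (uminus ` \<Lambda>)"
        "\<lambda>z. q * indicator (reflect_snd ` S) z"]
    by (auto simp: indicator_reflect_snd_image indicator_uminus_image[abs_def])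

  have 1: "(\<lambda>z. q * indicator (S - W) z) \<in> ?\<Gamma>q" if "(\<lambda>z. p * indicator W z) \<in> ?\<Gamma>p"
    using pq_coupling[OF that] by (simp add: conjugate_density_indicator[OF pq WS])

  have "transport_cost bilinear_cost (indicator S)
      = transport_cost bilinear_cost (indicator W) + transport_cost bilinear_cost (indicator (S - W))"
  proof -
    have "indicator S z = (indicator W z + indicator (S - W) z :: real)" for z
      using WS by (auto simp: indicator_def)
    then show ?thesis
      using int_cost[OF assms(9) WS] int_cost[of "S - W"] S assms(9)
      by (simp add: transport_cost_def distrib_left)
  qed
  then have 2: "transport_cost bilinear_cost (indicator W) + center_of_mass \<Omega> \<bullet> center_of_mass \<Lambda>
      = - transport_cost bilinear_cost (indicator (S - W))"
    using transport_cost_Times[OF \<Omega>(1,2) \<Lambda>(1,2)] by (simp add: S_def)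

  have 3: "- transport_cost bilinear_cost (indicator (S - W))
      = transport_cost bilinear_cost (indicator (reflect_snd ` (S - W)))"
    using transport_cost_reflect_snd[OF int_cost[of "S - W"]] S assms(9)
    by (simp add: indicator_reflect_snd_image[abs_def])

  \<comment> \<open>Conjugation followed by reflection, and its inverse.\<close>
  let ?F = "\<lambda>h z. conjugate_density q S h (reflect_snd z)"
  let ?F' = "\<lambda>k. conjugate_density p S (\<lambda>z. k (reflect_snd z))"
  have "minimizes_cost bilinear_cost ?\<Gamma>p (\<lambda>z. p * indicator W z)
      \<longleftrightarrow> minimizes_cost bilinear_cost ?\<Gamma>R (?F (\<lambda>z. p * indicator W z))"
  proof (rule minimizes_cost_iff_increasing_image[where F' = ?F'])
    show "?F h \<in> ?\<Gamma>R" if "h \<in> ?\<Gamma>p" for h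
      using pq_coupling[OF that] reflect_iff by blast
    show "?F' k \<in> ?\<Gamma>p" if "k \<in> ?\<Gamma>R" for k
      using qp_coupling reflect_iff[of "\<lambda>z. k (reflect_snd z)"] that by simp
    show "?F' (?F h) = h" for h
      by (simp add: conjugate_density_involutive[OF pq])
    show "?F (?F' k) = k" for k
      by (simp add: conjugate_density_involutive[OF qp])
    show "transport_cost bilinear_cost (?F h)
        = - q * transport_cost bilinear_cost (indicator S) + (q - 1) * transport_cost bilinear_cost h"
      if "h \<in> ?\<Gamma>p" for h
      using transport_cost_reflect_snd[OF integrable_bilinear_cost_coupling[OF S(1) pq_coupling[OF that]]]
        transport_cost_conjugate_density[OF integrable_bilinear_cost_coupling[OF S(1) that]
          int_cost[OF S(2) subset_refl], of q]
      by simp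
    show "q - 1 > 0"
      using qp by simp
  qed
  also have "?F (\<lambda>z. p * indicator W z) = (\<lambda>z. q * indicator (reflect_snd ` (S - W)) z)"
    by (simp add: conjugate_density_indicator[OF pq WS] indicator_reflect_snd_image)
  finally show ?thesis
    using 1 2 3 unfolding S_def by blast
qed

end
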